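(* The consistency checking procedure, i.e. the application of the constraint solving rules (Equals), (Feat), (FeatExists), (Subset), (TransConj), (TransClos), (Cycle), (DomPrec) to a set of constraints, terminates in a finite number of steps.
   Context: **Syntax.** Fix a set $\mathcal V$ of variables and two disjoint sets of symbols: $\mathcal F$ (relation symbols) and $\mathcal P$ (irreflexive relation symbols). For variables $x,y$, symbols $f,g\in\mathcal F$ and $p\in\mathcal P$, the constraints are the formal expressions - $x=y$ (equality), - $x=f:y$ (feature constraint), - $x=\exists f:y$ (set membership), - $x=\exists p^{+}:y$ (transitive closure) and $x=\exists p^{*}:y$ (reflexive-transitive closure), - $x=f:\supseteq g(y)$ (subset inclusion), - $x=[f\ p\ 1]\,y$ (first daughter), - $f(x):p^{+}:g(y)$ and $f(x):p^{*}:g(y)$ (domain precedence), and conjunctions of these. A set of constraints is identified with the conjunction of its members. **Constraint solving rules.** Each rule transforms the constraint system on the left of $\longmapsto$ into the one on the right. Within the rules, $D$ denotes the remaining constraints of the system, and $[x/y]D$ is $D$ with every occurrence of $x$ replaced by $y$. - (Equals): $x=y\wedge D\ \longmapsto\ x=y\wedge[x/y]D$, if $x\neq y$ and $x$ occurs in $D$. - (Feat): $x=f:y\wedge x=f:z\wedge D\ \longmapsto\ x=f:y\wedge y=z\wedge D$. - (FeatExists): $x=f:y\wedge x=\exists f:z\wedge D\ \longmapsto\ x=f:y\wedge x=\exists f:z\wedge y=z\wedge D$. - (Subset): $x=f:\supseteq g(y)\wedge y=G:z\wedge D\ \longmapsto\ x=\exists f:z\wedge x=f:\supseteq g(y)\wedge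 y=G:z\wedge D$, if $(x=\exists f:z)\notin D$, where $G$ ranges over $g,\exists g$. - (TransConj): $x=\exists p^{*}:y\wedge x=\exists p^{+}:y\wedge D\ \longmapsto\ x=\exists p^{+}:y\wedge D$. - (TransClos): $x=\exists R_1:y\wedge y=\exists R_2:z\wedge D\ \longmapsto\ x=\exists(R_1\times R_2):z\wedge x=\exists R_1:y\wedge y=\exists R_2:z\wedge D$, if $(x=\exists p^{+}:z)\notin D$ and $(x=\exists(R_1\times R_2):z)\notin D$, where $R_1,R_2\in\{p^+,p^*\}$, $p^*\times p^*=p^*$ and the other three products equal $p^+$. - (Cycle): $x=\exists p^{*}:y\wedge y=\exists p^{*}:x\wedge D\ \longmapsto\ x=y\wedge D$. - (DomPrec): $f(x):R:g(y)\wedge x=\exists f:x_1\wedge y=\exists g:y_1\wedge D\ \longmapsto\ x_1=\exists R:y_1\wedge f(x):R:g(y)\wedge x=\exists f:x_1\wedge y=\exists g:y_1\wedge D$, if $(x_1=\exists p^{+}:y_1)\notin D$ and $(x_1=\exists R:y_1)\notin D$, where $R$ ranges over $p^+,p^*$. A set of constraints is in normal form if no constraint solving rule is applicable to it; the procedure applies the rules to bring a set of constraints into normal form.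
   Formalization: Termination fails for arbitrary rule orders, so it is proved for runs where (Equals) is not neglected forever while continuously applicable; (Cycle) requires two distinct variables, a rule application must change the set of constraints, and the set is finite. *)

theory Defs
  imports Main
begin

datatype closure = Plus | Star

text \<open>
  The sets of variables, relation symbols and irreflexive relation symbols are the types
  \<open>'v\<close>, \<open>'f\<close> and \<open>'p\<close>, so the two kinds of symbols are disjoint by typing.
  The constructors stand for, in this order, \<open>x = y\<close>, \<open>x = f : y\<close>, \<open>x = \<exists>f : y\<close>,
  \<open>x = \<exists>R : y\<close> with \<open>R\<close> being \<open>p\<^sup>+\<close> or \<open>p\<^sup>*\<close>, \<open>x = f :\<supseteq> g(y)\<close>,
  \<open>x = [f p 1] y\<close>, and \<open>f(x) : R : g(y)\<close>.
\<close>

datatype (vars: 'v, 'f, 'p) constr =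
    Equal 'v 'v
  | Feature 'v 'f 'v
  | Member 'v 'f 'v
  | Closure 'v 'p closure 'v
  | Includes 'v 'f 'f 'v
  | FirstDaughter 'v 'f 'p 'v
  | Precedes 'f 'v 'p closure 'f 'v

text \<open>\<open>subst x y c\<close> replaces every occurrence of \<open>x\<close> in \<open>c\<close> by \<open>y\<close>.\<close>

definition subst :: "'v \<Rightarrow> 'v \<Rightarrow> ('v, 'f, 'p) constr \<Rightarrow> ('v, 'f, 'p) constr" where
  "subst x y = map_constr (\<lambda>v. if v = x then y else v) id id"

fun closure_times :: "closure \<Rightarrow> closure \<Rightarrow> closure" where
  "closure_times Star Star = Star"
| "closure_times _ _ = Plus"

datatype rule = Equals | Feat | FeatExists | Subset | TransConj | TransClos | Cycle | DomPrec

text \<open>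
  A conjunction is the set of its conjuncts, and \<open>D\<close> is the set of the remaining constraints,
  hence disjoint from the displayed ones. As conjunction is idempotent, two displayed
  constraints may be matched by the same member of the system; for example, DomPrec must be able
  to derive \<open>x1 = \<exists>R : x1\<close> from \<open>f(x) : R : f(x)\<close> and \<open>x = \<exists>f : x1\<close>.
  The exception is Cycle, which consumes two different constraints: with \<open>x = y\<close> it would
  turn \<open>x = \<exists>p\<^sup>* : x\<close> into \<open>x = x\<close>, and TransClos could restore the deleted constraint
  from \<open>x = \<exists>p\<^sup>* : z\<close> and \<open>z = \<exists>p\<^sup>* : x\<close> over and over again.
\<close>

inductive transforms :: "rule \<Rightarrow> ('v, 'f, 'p) constr set \<Rightarrow> ('v, 'f, 'p) constr set \<Rightarrow> bool" where
  equals: "transforms Equals ({Equal x y} \<union> D) ({Equal x y} \<union> subst x y ` D)"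
    if "{Equal x y} \<inter> D = {}" "x \<noteq> y" "\<exists>c\<in>D. x \<in> vars c"
| feat: "transforms Feat ({Feature x f y, Feature x f z} \<union> D) ({Feature x f y, Equal y z} \<union> D)"
    if "{Feature x f y, Feature x f z} \<inter> D = {}"
| feat_exists: "transforms FeatExists ({Feature x f y, Member x f z} \<union> D)
      ({Feature x f y, Member x f z, Equal y z} \<union> D)"
    if "{Feature x f y, Member x f z} \<inter> D = {}"
| subset: "transforms Subset ({Includes x f g y, c} \<union> D)
      ({Member x f z, Includes x f g y, c} \<union> D)"
    if "{Includes x f g y, c} \<inter> D = {}" "c = Feature y g z \<or> c = Member y g z"
       "Member x f z \<notin> D"
| trans_conj: "transforms TransConj ({Closure x p Star y, Closure x p Plus y} \<union> D)
      ({Closure x p Plus y} \<union> D)"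
    if "{Closure x p Star y, Closure x p Plus y} \<inter> D = {}"
| trans_clos: "transforms TransClos ({Closure x p R1 y, Closure y p R2 z} \<union> D)
      ({Closure x p (closure_times R1 R2) z, Closure x p R1 y, Closure y p R2 z} \<union> D)"
    if "{Closure x p R1 y, Closure y p R2 z} \<inter> D = {}"
       "Closure x p Plus z \<notin> D" "Closure x p (closure_times R1 R2) z \<notin> D"
| cycle: "transforms Cycle ({Closure x p Star y, Closure y p Star x} \<union> D) ({Equal x y} \<union> D)"
    if "{Closure x p Star y, Closure y p Star x} \<inter> D = {}" "x \<noteq> y"
| dom_prec: "transforms DomPrec ({Precedes f x p R g y, Member x f x1, Member y g y1} \<union> D)
      ({Closure x1 p R y1, Precedes f x p R g y, Member x f x1, Member y g y1} \<union> D)"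
    if "{Precedes f x p R g y, Member x f x1, Member y g y1} \<inter> D = {}"
       "Closure x1 p Plus y1 \<notin> D" "Closure x1 p R y1 \<notin> D"

text \<open>
  A rule counts as applied only if it changes the system. Otherwise FeatExists, which has no side
  condition, would stay applicable to its own result, and systems containing its left-hand side
  would never reach a normal form.
\<close>

definition step :: "rule \<Rightarrow> ('v, 'f, 'p) constr set \<Rightarrow> ('v, 'f, 'p) constr set \<Rightarrow> bool" where
  "step r C C' \<longleftrightarrow> transforms r C C' \<and> C' \<noteq> C"

definition applicable :: "rule \<Rightarrow> ('v, 'f, 'p) constr set \<Rightarrow> bool" where
  "applicable r C \<longleftrightarrow> (\<exists>C'. step r C C')"

text \<open>
  The rules may be applied in any order, except that Equals must not be neglected forever while
  it is applicable all the time. Termination fails without this proviso: in the closure under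
  \<open>p\<^sup>*\<close> of three variables, Cycle may delete the two constraints between \<open>x\<close> and \<open>y\<close>,
  and TransClos may restore both via the third variable, see \<open>nontermination_without_fairness\<close>.
\<close>

definition fair :: "(nat \<Rightarrow> ('v, 'f, 'p) constr set) \<Rightarrow> bool" where
  "fair S \<longleftrightarrow> (\<forall>i. (\<forall>j\<ge>i. applicable Equals (S j)) \<longrightarrow> (\<exists>j\<ge>i. step Equals (S j) (S (Suc j))))"

lemma nontermination_without_fairness:
  fixes p :: 'p and x y z :: 'v
  assumes "distinct [x, y, z]"
  shows "\<exists>S :: nat \<Rightarrow> ('v, 'f, 'p) constr set. finite (S 0) \<and> (\<forall>i. \<exists>r. step r (S i) (S (Suc i)))"
proof -
  let ?a = "\<lambda>u v. Closure u p Star v :: ('v, 'f, 'p) constr"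
  define A where "A = {Equal x y, ?a x z, ?a z x, ?a y z, ?a z y}"
  define S where "S = (\<lambda>i::nat. if i mod 3 = 0 then {?a x y, ?a y x} \<union> A
    else if i mod 3 = 1 then A else {?a x y} \<union> A)"
  have A: "{Equal x y} \<union> A = A"
    "{?a x z, ?a z y} \<union> {Equal x y, ?a z x, ?a y z} = A"
    "{?a x y, ?a x z, ?a z y} \<union> {Equal x y, ?a z x, ?a y z} = {?a x y} \<union> A"
    "{?a y z, ?a z x} \<union> {Equal x y, ?a x y, ?a x z, ?a z y} = {?a x y} \<union> A"
    "{?a y x, ?a y z, ?a z x} \<union> {Equal x y, ?a x y, ?a x z, ?a z y} = {?a x y, ?a y x} \<union> A"
    by (auto simp: A_def)
  have xy: "?a x y \<notin> A" "?a y x \<notin> A" "?a x y \<noteq> ?a y x"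
    using assms by (auto simp: A_def)
  have "transforms Cycle ({?a x y, ?a y x} \<union> A) ({Equal x y} \<union> A)"
    by (rule cycle) (use assms xy in auto)
  then have 1: "step Cycle ({?a x y, ?a y x} \<union> A) A"
    using xy unfolding step_def A(1) by blast
  have "transforms TransClos ({?a x z, ?a z y} \<union> {Equal x y, ?a z x, ?a y z})
      ({Closure x p (closure_times Star Star) y, ?a x z, ?a z y} \<union> {Equal x y, ?a z x, ?a y z})"
    by (rule trans_clos) (use assms in auto)
  then have 2: "step TransClos A ({?a x y} \<union> A)"
    using xy unfolding step_def closure_times.simps A by blast
  have "transforms TransClos ({?a y z, ?a z x} \<union> {Equal x y, ?a x y, ?a x z, ?a z y})
      ({Closure y p (closure_times Star Star) x, ?a y z, ?a z x} \<union>
       {Equal x y, ?a x y, ?a x z, ?a z y})"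
    by (rule trans_clos) (use assms in auto)
  then have 3: "step TransClos ({?a x y} \<union> A) ({?a x y, ?a y x} \<union> A)"
    using xy unfolding step_def closure_times.simps A by blast
  have "\<exists>r. step r (S i) (S (Suc i))" for i
  proof -
    consider "i mod 3 = 0" | "i mod 3 = 1" | "i mod 3 = 2" by linarith
    then show ?thesis
      using 1 2 3 by cases (auto simp: S_def mod_Suc)
  qed
  then show ?thesis by (intro exI[of _ S]) (simp add: S_def A_def)
qed

end

theory Submission
  imports Defs
begin

text \<open>
  All systems of a run live in a finite universe of constraints. Call a variable solved if it
  occurs only as the left-hand side of a single nontrivial equation. Solved variables stay solved,
  and Equals solves a new one, so eventually Equals is no longer applied. From then on only
  constraints \<open>x = f : y\<close> and \<open>x = \<exists>p\<^sup>* : y\<close> can be deleted, so eventually the set of all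
  other constraints is constant. By fairness Equals is inapplicable at some later time. Then all
  variables on the left of nontrivial equations are solved, and this persists, so Cycle, and
  Feat with distinct right-hand sides, can no longer be applied: they would need an equation for a
  variable that still occurs elsewhere.
  What remains is TransConj, which lowers the number of redundant pairs \<open>p\<^sup>*\<close>, \<open>p\<^sup>+\<close>,
  and rules that enlarge the system without creating such pairs.
\<close>

definition universe :: "'v set \<Rightarrow> 'f set \<Rightarrow> 'p set \<Rightarrow> ('v, 'f, 'p) constr set" where
  "universe V F P = {c. vars c \<subseteq> V \<and> set2_constr c \<subseteq> F \<and> set3_constr c \<subseteq> P}"

definition solved :: "('v, 'f, 'p) constr set \<Rightarrow> 'v set" where
  "solved C = {x. \<exists>y. x \<noteq> y \<and> Equal x y \<in> C \<and> (\<forall>c\<in>C. x \<in> vars c \<longrightarrow> c = Equal x y)}"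

definition deletable :: "('v, 'f, 'p) constr set" where
  "deletable = {c. \<exists>x f p y. c = Feature x f y \<or> c = Closure x p Star y}"

definition redundant :: "('v, 'f, 'p) constr set \<Rightarrow> ('v, 'f, 'p) constr set" where
  "redundant C = {c \<in> C. \<exists>x p y. c = Closure x p Star y \<and> Closure x p Plus y \<in> C}"

section \<open>The finite universe of constraints\<close>

lemma finite_closure_UNIV: "finite (UNIV :: closure set)"
  by (rule finite_subset[of _ "{Plus, Star}"]) (use closure.exhaust in auto)

lemma finite_universe:
  assumes "finite V" "finite F" "finite P"
  shows "finite (universe V F P)"
proof -
  let ?R = "UNIV :: closure set"
  have "universe V F P \<subseteq>
      (\<lambda>(x, y). Equal x y) ` (V \<times> V) \<union>
      (\<lambda>(x, f, y). Feature x f y) ` (V \<times> F \<times> V) \<union>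
      (\<lambda>(x, f, y). Member x f y) ` (V \<times> F \<times> V) \<union>
      (\<lambda>(x, p, R, y). Closure x p R y) ` (V \<times> P \<times> ?R \<times> V) \<union>
      (\<lambda>(x, f, g, y). Includes x f g y) ` (V \<times> F \<times> F \<times> V) \<union>
      (\<lambda>(x, f, p, y). FirstDaughter x f p y) ` (V \<times> F \<times> P \<times> V) \<union>
      (\<lambda>(f, x, p, R, g, y). Precedes f x p R g y) ` (F \<times> V \<times> P \<times> ?R \<times> F \<times> V)" (is "_ \<subseteq> ?B")
  proof
    fix c assume "c \<in> universe V F P"
    then show "c \<in> ?B"
      by (cases c) (auto simp: universe_def image_iff)
  qed
  then show ?thesis
    by (rule finite_subset)
      (intro finite_UnI finite_imageI finite_cartesian_product assms finite_closure_UNIV)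
qed

lemma finite_constr_sets:
  "finite (vars c)" "finite (set2_constr c)" "finite (set3_constr c)"
  by (cases c; simp)+

lemma vars_subst: "vars (subst x y c) = (\<lambda>v. if v = x then y else v) ` vars c"
  by (simp add: subst_def constr.set_map)

lemma subst_universe:
  assumes "c \<in> universe V F P" "y \<in> V"
  shows "subst x y c \<in> universe V F P"
  using assms by (auto simp: universe_def subst_def constr.set_map)

text \<open>No rule invents a variable or a symbol; in particular the variable that Equals
  substitutes already occurs in the displayed equation.\<close>

lemma transforms_universe:
  assumes "transforms r C C'" "C \<subseteq> universe V F P"
  shows "C' \<subseteq> universe V F P"
  using assms
proof cases
  case (equals x y D)
  then have "y \<in> V" using assms(2) by (simp add: universe_def)
  have "subst x y ` D \<subseteq> universe V F P"
  proof (rule image_subsetI)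
    fix c assume "c \<in> D"
    then show "subst x y c \<in> universe V F P"
      using equals assms(2) \<open>y \<in> V\<close> by (intro subst_universe) auto
  qed
  then show ?thesis using equals assms(2) by simp
qed (auto simp: universe_def)

section \<open>Persistence of solved variables\<close>

text \<open>Besides Equals only Feat, TransConj and Cycle delete anything: a feature constraint, or
  closure constraints with \<open>Star\<close>.\<close>

lemma nonequals_keeps:
  assumes "transforms r C C'" "r \<noteq> Equals"
  shows "C - deletable \<subseteq> C' - deletable"
  using assms by cases (auto simp: deletable_def)

text \<open>A solved variable occurs in an equation only, so it cannot enter a new constraint. This
  is what keeps it solved under all rules but Equals.\<close>

lemma nonequals_vars:
  assumes "transforms r C C'" "r \<noteq> Equals" "c \<in> C' - C" "v \<in> vars c"
  shows "\<exists>c'\<in>C. v \<in> vars c' \<and> (\<forall>x y. c' \<noteq> Equal x y)"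
  using assms
proof cases
  case (subset x f g y d D z)
  then have "v \<in> vars (Includes x f g y) \<or> v \<in> vars d"
    using assms(3,4) by auto
  then show ?thesis using subset by blast
next
  case (trans_clos x p R1 y R2 z D)
  then have "v \<in> vars (Closure x p R1 y) \<or> v \<in> vars (Closure y p R2 z)"
    using assms(3,4) by auto
  then show ?thesis using trans_clos by blast
next
  case (dom_prec f x p R g y x1 y1 D)
  then have "v \<in> vars (Member x f x1) \<or> v \<in> vars (Member y g y1)"
    using assms(3,4) by auto
  then show ?thesis using dom_prec by blast
qed auto

lemma solved_mono:
  fixes C :: "('v, 'f, 'p) constr set"
  assumes "transforms r C C'"
  shows "solved C \<subseteq> solved C'"
proof
  fix x assume "x \<in> solved C"
  then obtain y where y: "x \<noteq> y" "Equal x y \<in> C"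
    and only: "\<And>c. c \<in> C \<Longrightarrow> x \<in> vars c \<Longrightarrow> c = Equal x y"
    by (auto simp: solved_def)
  show "x \<in> solved C'"
  proof (cases "r = Equals")
    case True
    with assms obtain a b D where C: "C = {Equal a b} \<union> D" and C': "C' = {Equal a b} \<union> subst a b ` D"
      and D: "{Equal a b} \<inter> D = {}" "a \<noteq> b" "\<exists>c\<in>D. a \<in> vars c"
      by cases auto
    obtain d where d: "d \<in> D" "a \<in> vars d" using D by blast
    \<comment> \<open>Being solved, \<open>x\<close> is on neither side of the equation used: as
      left-hand side it would not occur in \<open>D\<close>, and as right-hand side it would occur
      in an equation for another variable.\<close>
    have xa: "x \<noteq> a"
    proof
      assume "x = a"
      then have "Equal a b = Equal x y" "d = Equal x y"
        using only[of "Equal a b"] only[of d] C d by auto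
      then show False using D d by auto
    qed
    then have xb: "x \<noteq> b"
      using C only[of "Equal a b"] by auto
    have xD: "Equal x y \<in> D"
      using y C xa by auto
    \<comment> \<open>The equation for \<open>x\<close> survives, but the substitution may rewrite
      its right-hand side, so the witness changes from \<open>y\<close> to \<open>z\<close>.\<close>
    define z where "z = (if y = a then b else y)"
    have z: "subst a b (Equal x y) = (Equal x z :: ('v, 'f, 'p) constr)"
      using xa by (simp add: z_def subst_def)
    have "x \<noteq> z"
      using y xb by (simp add: z_def)
    moreover have "Equal x z \<in> C'"
      unfolding C' using imageI[OF xD, of "subst a b"] z by simp
    moreover have "c = Equal x z" if c: "c \<in> C'" "x \<in> vars c" for c
    proof -
      from c xa xb obtain e where e: "e \<in> D" "c = subst a b e"
        unfolding C' by auto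
      then have "x \<in> vars e"
        using c(2) xb by (auto simp: vars_subst split: if_splits)
      then have "e = Equal x y"
        using e(1) C by (intro only) auto
      then show ?thesis
        using e(2) z by simp
    qed
    ultimately have "x \<noteq> z" "Equal x z \<in> C'" "\<forall>c\<in>C'. x \<in> vars c \<longrightarrow> c = Equal x z"
      by blast+
    then show ?thesis
      unfolding solved_def by blast
  next
    case False
    have "Equal x y \<in> C'"
      using nonequals_keeps[OF assms False] y by (auto simp: deletable_def)
    moreover have "c = Equal x y" if "c \<in> C'" "x \<in> vars c" for c
      using nonequals_vars[OF assms False, of c x] only that by blast
    ultimately show ?thesis
      using y unfolding solved_def by blast
  qed
qed

lemma equals_solves:
  fixes C :: "('v, 'f, 'p) constr set"
  assumes "transforms Equals C C'"
  shows "\<exists>x y. x \<noteq> y \<and> Equal x y \<in> C \<and> x \<notin> solved C \<and> x \<in> solved C'"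
  using assms
proof cases
  case (equals x y D)
  have "x \<notin> solved C"
  proof
    assume "x \<in> solved C"
    then obtain z where z: "\<And>c. c \<in> C \<Longrightarrow> x \<in> vars c \<Longrightarrow> c = Equal x z"
      unfolding solved_def by blast
    have "Equal x y = (Equal x z :: ('v, 'f, 'p) constr)"
      using z[of "Equal x y"] equals by auto
    with z have "c = Equal x y" if "c \<in> C" "x \<in> vars c" for c
      using that by simp
    with equals show False by blast
  qed
  moreover have "x \<in> solved C'"
    using equals by (auto simp: solved_def vars_subst split: if_splits)
  ultimately show ?thesis
    using equals by blast
qed

text \<open>This reduces applicability to the nontrivial equations present and the solved variables,
  both of which can be tracked along a run.\<close>

lemma applicable_Equals_iff:
  "applicable Equals C \<longleftrightarrow> (\<exists>x y. x \<noteq> y \<and> Equal x y \<in> C \<and> x \<notin> solved C)"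
proof
  assume "applicable Equals C"
  then show "\<exists>x y. x \<noteq> y \<and> Equal x y \<in> C \<and> x \<notin> solved C"
    unfolding applicable_def step_def using equals_solves by blast
next
  assume "\<exists>x y. x \<noteq> y \<and> Equal x y \<in> C \<and> x \<notin> solved C"
  then obtain x y c where c: "x \<noteq> y" "Equal x y \<in> C" "c \<in> C" "x \<in> vars c" "c \<noteq> Equal x y"
    unfolding solved_def by blast
  define D where "D = C - {Equal x y}"
  have C: "C = {Equal x y} \<union> D"
    using c by (auto simp: D_def)
  have "transforms Equals C ({Equal x y} \<union> subst x y ` D)"
    unfolding C by (rule equals) (use c in \<open>auto simp: D_def\<close>)
  \<comment> \<open>The substitution eliminates \<open>x\<close>, which occurs in \<open>c\<close>,
    so the system really changes.\<close>
  moreover have "c \<notin> {Equal x y} \<union> subst x y ` D"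
    using c by (auto simp: vars_subst split: if_splits)
  ultimately show "applicable Equals C"
    unfolding applicable_def step_def using c by blast
qed

text \<open>Equations are not deletable, so the step adds none, and solved variables stay
  solved.\<close>

lemma applicable_Equals_antimono:
  assumes "transforms r C C'" "C' - deletable = C - deletable" "\<not> applicable Equals C"
  shows "\<not> applicable Equals C'"
proof -
  have "Equal x y \<in> C" if "Equal x y \<in> C'" for x y
    using that assms(2) by (auto simp: deletable_def)
  then show ?thesis
    using assms(3) solved_mono[OF assms(1)] unfolding applicable_Equals_iff by blast
qed

section \<open>Progress of the remaining rules\<close>

lemma closure_times_Star: "closure_times R S = Star \<longleftrightarrow> R = Star \<and> S = Star"
  by (cases R; cases S) auto

lemma star_step_progress:
  assumes step: "step r C C'" and "r \<noteq> Equals"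
    and const: "C' - deletable = C - deletable" and inapp: "\<not> applicable Equals C"
  shows "redundant C' \<subset> redundant C \<or> redundant C' = redundant C \<and> C \<subset> C'"
proof -
  have tr: "transforms r C C'" and "C' \<noteq> C"
    using step by (auto simp: step_def)
  have new: "c \<in> C" if "c \<in> C'" "c \<notin> deletable" for c
    using const that by blast
  \<comment> \<open>Common to TransClos and DomPrec: a new constraint must be deletable, which
    forces \<open>Star\<close>, and the side condition of the rule excludes the \<open>Plus\<close>
    partner, so no redundant pair arises.\<close>
  have grows: ?thesis
    if C': "C' = insert (Closure x p R y) C" and no_plus: "Closure x p Plus y \<notin> C" for x p R y
  proof -
    have "R = Star"
      using new[of "Closure x p R y"] C' \<open>C' \<noteq> C\<close> by (cases R) (auto simp: deletable_def)
    then have "redundant C' = redundant C"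
      using C' no_plus by (auto simp: redundant_def)
    then show ?thesis using C' \<open>C' \<noteq> C\<close> by blast
  qed
  from tr show ?thesis
  proof cases
    case (feat x f y z D)
    then have eq: "Equal y z \<in> C"
      using new[of "Equal y z"] by (auto simp: deletable_def)
    have "y = z"
    proof (rule ccontr)
      assume "y \<noteq> z"
      then have "y \<in> solved C"
        using inapp eq unfolding applicable_Equals_iff by blast
      moreover have "Feature x f y \<in> C" "y \<in> vars (Feature x f y)"
        using feat by auto
      ultimately show False unfolding solved_def by blast
    qed
    \<comment> \<open>For \<open>y = z\<close> the two feature constraints coincide and the equation
      is already present, so nothing would change.\<close>
    then show ?thesis using feat eq \<open>C' \<noteq> C\<close> by blast
  next
    case (feat_exists x f y z D)
    then have "Equal y z \<in> C"
      using new[of "Equal y z"] by (auto simp: deletable_def)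
    then show ?thesis using feat_exists \<open>C' \<noteq> C\<close> by blast
  next
    case (subset x f g y c D z)
    then have "Member x f z \<in> C"
      using new[of "Member x f z"] by (auto simp: deletable_def)
    then show ?thesis using subset \<open>C' \<noteq> C\<close> by blast
  next
    case (trans_conj x p y D)
    then have "Closure x p Star y \<in> redundant C - redundant C'"
      by (auto simp: redundant_def)
    moreover have "redundant C' \<subseteq> redundant C"
      using trans_conj by (auto simp: redundant_def)
    ultimately show ?thesis by blast
  next
    case (trans_clos x p R1 y R2 z D)
    show ?thesis
    proof (cases "closure_times R1 R2")
      case Plus
      then have "Closure x p Plus z \<in> C"
        using new[of "Closure x p Plus z"] trans_clos by (auto simp: deletable_def)
      then show ?thesis using trans_clos Plus \<open>C' \<noteq> C\<close> by auto
    next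
      case Star
      then have "R1 = Star" "R2 = Star" by (simp_all add: closure_times_Star)
      then show ?thesis
        using trans_clos by (intro grows[of x p Star z]) auto
    qed
  next
    case (cycle x p y D)
    then have "Equal x y \<in> C"
      using new[of "Equal x y"] by (auto simp: deletable_def)
    then have "x \<in> solved C"
      using inapp cycle unfolding applicable_Equals_iff by blast
    moreover have "Closure x p Star y \<in> C" "x \<in> vars (Closure x p Star y)"
      using cycle by auto
    ultimately show ?thesis unfolding solved_def by blast
  next
    case (dom_prec f x p R g y x1 y1 D)
    then show ?thesis by (intro grows[of x1 p R y1]) auto
  qed (use \<open>r \<noteq> Equals\<close> in simp)
qed

section \<open>Stabilisation of monotone sequences\<close>

lemma nat_decreasing_stabilises:
  fixes f :: "nat \<Rightarrow> nat"
  assumes "\<And>i. i \<ge> n \<Longrightarrow> f (Suc i) \<le> f i"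
  obtains m where "m \<ge> n" "\<And>i. i \<ge> m \<Longrightarrow> f i = f m"
proof -
  obtain m where m: "m \<ge> n" "\<And>i. i \<ge> n \<Longrightarrow> f m \<le> f i"
    using ex_has_least_nat[of "\<lambda>i. i \<ge> n" n f] by auto
  have "f i \<le> f m" if "i \<ge> m" for i
    using that
  proof (induction i rule: dec_induct)
    case (step i)
    then show ?case using assms[of i] m(1) by linarith
  qed simp
  then show thesis
    using m that by (meson le_antisym le_trans)
qed

text \<open>The complements in \<open>U\<close> shrink, so their cardinalities become constant, and
  then the complements themselves do. The threshold \<open>n\<close> admits sequences that are
  monotone only from some index on.\<close>

lemma increasing_stabilises:
  fixes A :: "nat \<Rightarrow> 'a set"
  assumes "finite U" "\<And>i. A i \<subseteq> U" "\<And>i. i \<ge> n \<Longrightarrow> A i \<subseteq> A (Suc i)"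
  obtains m where "m \<ge> n" "\<And>i. i \<ge> m \<Longrightarrow> A (Suc i) = A i"
proof -
  have fin: "finite (U - A i)" for i
    using assms(1) by simp
  have anti: "U - A (Suc i) \<subseteq> U - A i" if "i \<ge> n" for i
    using assms(3)[OF that] by (rule Diff_mono[OF order_refl])
  obtain m where m: "m \<ge> n" "\<And>i. i \<ge> m \<Longrightarrow> card (U - A i) = card (U - A m)"
    using nat_decreasing_stabilises[of n "\<lambda>i. card (U - A i)", OF card_mono[OF fin anti]] by blast
  have "A (Suc i) = A i" if "i \<ge> m" for i
  proof -
    have "card (U - A (Suc i)) = card (U - A i)"
      using m(2)[of i] m(2)[of "Suc i"] that by simp
    moreover have "U - A (Suc i) \<subseteq> U - A i"
      using anti m(1) that by simp
    ultimately have "U - A (Suc i) = U - A i"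
      using card_subset_eq[OF fin] by blast
    then show ?thesis using assms(2)[of i] assms(2)[of "Suc i"] by blast
  qed
  then show thesis using m(1) that by blast
qed

section \<open>Termination of fair runs\<close>

theorem theorem3:
  fixes C :: "('v, 'f, 'p) constr set"
  assumes "finite C"
  shows "\<not> (\<exists>S :: nat \<Rightarrow> ('v, 'f, 'p) constr set.
            S 0 = C \<and> (\<forall>i. \<exists>r. step r (S i) (S (Suc i))) \<and> fair S)"
proof
  assume "\<exists>S :: nat \<Rightarrow> ('v, 'f, 'p) constr set.
            S 0 = C \<and> (\<forall>i. \<exists>r. step r (S i) (S (Suc i))) \<and> fair S"
  then obtain S where S0: "S 0 = C" and "\<forall>i. \<exists>r. step r (S i) (S (Suc i))" and fair: "fair S"
    by blast
  then obtain r where step: "step (r i) (S i) (S (Suc i))" for i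
    by metis
  then have tr: "transforms (r i) (S i) (S (Suc i))" for i
    by (simp add: step_def)
  define V where "V = (\<Union>c\<in>C. vars c)"
  define U where "U = universe V (\<Union>c\<in>C. set2_constr c) (\<Union>c\<in>C. set3_constr c)"
  have "finite V"
    using assms by (simp add: V_def finite_constr_sets)
  then have "finite U"
    using assms by (simp add: U_def finite_universe finite_constr_sets)
  have SU: "S i \<subseteq> U" for i
  proof (induction i)
    case 0
    then show ?case by (auto simp: S0 U_def V_def universe_def)
  next
    case (Suc i)
    then show ?case using transforms_universe[OF tr] unfolding U_def by blast
  qed
  have "solved (S i) \<subseteq> V" for i
    using SU[of i] by (fastforce simp: solved_def U_def universe_def)
  then obtain k where k: "\<And>i. i \<ge> k \<Longrightarrow> solved (S (Suc i)) = solved (S i)"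
    using increasing_stabilises[OF \<open>finite V\<close>, of "\<lambda>i. solved (S i)" 0] solved_mono[OF tr] by auto
  have neq: "r i \<noteq> Equals" if "i \<ge> k" for i
    using k[OF that] equals_solves tr[of i] by metis
  obtain m where m: "m \<ge> k" "\<And>i. i \<ge> m \<Longrightarrow> S (Suc i) - deletable = S i - deletable"
    using increasing_stabilises[OF \<open>finite U\<close>, of "\<lambda>i. S i - deletable" k] SU
      nonequals_keeps[OF tr neq] by blast
  have "\<not> step Equals (S i) (S (Suc i))" if "i \<ge> k" for i
    using k[OF that] equals_solves unfolding step_def by metis
  \<comment> \<open>If Equals were applicable at all times from \<open>m\<close> on, fairness would
    force an Equals step, which would solve a new variable.\<close>
  then obtain j where j: "j \<ge> m" "\<not> applicable Equals (S j)"
    using fair m(1) unfolding fair_def by (meson le_trans)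
  have inapp: "\<not> applicable Equals (S i)" if "i \<ge> j" for i
    using that
  proof (induction i rule: dec_induct)
    case base
    show ?case by (rule j(2))
  next
    case (step i)
    then show ?case
      using applicable_Equals_antimono[OF tr m(2)] j(1) by simp
  qed
  define T where "T i = S (j + i)" for i
  have progress: "redundant (T (Suc i)) \<subset> redundant (T i) \<or>
      redundant (T (Suc i)) = redundant (T i) \<and> T i \<subset> T (Suc i)" for i
    unfolding T_def add_Suc_right
    by (rule star_step_progress[OF step]) (use neq m j inapp in auto)
  have finT: "finite (T i)" for i
    unfolding T_def using SU \<open>finite U\<close> by (rule finite_subset)
  then have fin: "finite (redundant (T i))" for i
    by (simp add: redundant_def)
  \<comment> \<open>Lexicographic descent: either redundant constraints disappear, or their set is
    kept while the system grows inside \<open>U\<close>.\<close>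
  have "(T (Suc i), T i) \<in> measures [\<lambda>X. card (redundant X), \<lambda>X. card (U - X)]" for i
    using progress[of i]
  proof
    assume "redundant (T (Suc i)) \<subset> redundant (T i)"
    then show ?thesis using psubset_card_mono[OF fin] by simp
  next
    assume *: "redundant (T (Suc i)) = redundant (T i) \<and> T i \<subset> T (Suc i)"
    have "T (Suc i) \<subseteq> U"
      using SU by (simp add: T_def)
    with * have "card (U - T (Suc i)) < card (U - T i)"
      using \<open>finite U\<close> by (intro psubset_card_mono) auto
    with * show ?thesis by simp
  qed
  moreover have "wf (measures [\<lambda>X. card (redundant X), \<lambda>X. card (U - X)])"
    by (rule wf_measures)
  ultimately show False
    unfolding wf_iff_no_infinite_down_chain by blast
qed

end
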